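(* Let $\mathbf{k}$ be a field of characteristic $0$. Every multiplicative right Hom-alternative algebra $(A,\mu,\alpha)$ over $\mathbf{k}$ is Hom-power associative, i.e., $x^n=x^{n-i,i}$ for all $x\in A$, all $n\ge 2$ and all $i\in\{1,\ldots,n-1\}$.
   Context: We work over a fixed field $\mathbf{k}$ of characteristic $0$. A Hom-algebra is a triple $(A,\mu,\alpha)$ where $A$ is a $\mathbf{k}$-module, $\mu\colon A^{\otimes 2}\to A$ is bilinear (written $xy=\mu(x,y)$), and $\alpha\colon A\to A$ is linear. It is multiplicative if $\alpha(xy)=\alpha(x)\alpha(y)$ for all $x,y\in A$. It is right Hom-alternative if $(xy)\alpha(y)=\alpha(x)(yy)$ for all $x,y\in A$. Powers of $\alpha$ are compositions, $\alpha^0=Id$. For $x\in A$, the $n$th Hom-power is defined inductively by $x^1=x$ and $x^n=x^{n-1}\alpha^{n-2}(x)$ for $n\ge 2$. For positive integers $i,j$, set $x^{i,j}=\alpha^{j-1}(x^i)\,\alpha^{i-1}(x^j)$. $A$ is $n$th Hom-power associative if $x^n=x^{n-i,i}$ for all $x\in A$ and $i\in\{1,\ldots,n-1\}$, and Hom-power associative if this holds for all $n\ge 2$. *)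

theory Defs
  imports Complex_Main
begin

locale hom_algebra = vector_space scale
  for scale :: "'k::field \<Rightarrow> 'a::ab_group_add \<Rightarrow> 'a" +
  fixes \<mu> :: "'a \<Rightarrow> 'a \<Rightarrow> 'a" and \<alpha> :: "'a \<Rightarrow> 'a"
  assumes linear_mult_left: "\<And>y. Vector_Spaces.linear scale scale (\<lambda>x. \<mu> x y)"
    and linear_mult_right: "\<And>x. Vector_Spaces.linear scale scale (\<lambda>y. \<mu> x y)"
    and linear_twist: "Vector_Spaces.linear scale scale \<alpha>"

definition multiplicative :: "('a \<Rightarrow> 'a \<Rightarrow> 'a) \<Rightarrow> ('a \<Rightarrow> 'a) \<Rightarrow> bool" where
  "multiplicative \<mu> \<alpha> \<longleftrightarrow> (\<forall>x y. \<alpha> (\<mu> x y) = \<mu> (\<alpha> x) (\<alpha> y))"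

definition right_hom_alternative :: "('a \<Rightarrow> 'a \<Rightarrow> 'a) \<Rightarrow> ('a \<Rightarrow> 'a) \<Rightarrow> bool" where
  "right_hom_alternative \<mu> \<alpha> \<longleftrightarrow> (\<forall>x y. \<mu> (\<mu> x y) (\<alpha> y) = \<mu> (\<alpha> x) (\<mu> y y))"

text \<open>Hom-powers are only meaningful for exponents at least 1; the value at exponent 0 is a
  placeholder that is never used below.\<close>

fun hom_power :: "('a::zero \<Rightarrow> 'a \<Rightarrow> 'a) \<Rightarrow> ('a \<Rightarrow> 'a) \<Rightarrow> 'a \<Rightarrow> nat \<Rightarrow> 'a" where
  "hom_power \<mu> \<alpha> x 0 = 0"
| "hom_power \<mu> \<alpha> x (Suc 0) = x"
| "hom_power \<mu> \<alpha> x (Suc (Suc n)) = \<mu> (hom_power \<mu> \<alpha> x (Suc n)) ((\<alpha> ^^ n) x)"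

text \<open>\<open>hom_power2 \<mu> \<alpha> x i j\<close> is $x^{i,j}$, for positive \<open>i\<close> and \<open>j\<close>.\<close>

definition hom_power2 ::
    "('a::zero \<Rightarrow> 'a \<Rightarrow> 'a) \<Rightarrow> ('a \<Rightarrow> 'a) \<Rightarrow> 'a \<Rightarrow> nat \<Rightarrow> nat \<Rightarrow> 'a" where
  "hom_power2 \<mu> \<alpha> x i j =
     \<mu> ((\<alpha> ^^ (j - 1)) (hom_power \<mu> \<alpha> x i)) ((\<alpha> ^^ (i - 1)) (hom_power \<mu> \<alpha> x j))"

definition nth_hom_power_associative ::
    "nat \<Rightarrow> ('a::zero \<Rightarrow> 'a \<Rightarrow> 'a) \<Rightarrow> ('a \<Rightarrow> 'a) \<Rightarrow> bool" where
  "nth_hom_power_associative n \<mu> \<alpha> \<longleftrightarrow>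
     (\<forall>x. \<forall>i\<in>{1..n - 1}. hom_power \<mu> \<alpha> x n = hom_power2 \<mu> \<alpha> x (n - i) i)"

definition hom_power_associative :: "('a::zero \<Rightarrow> 'a \<Rightarrow> 'a) \<Rightarrow> ('a \<Rightarrow> 'a) \<Rightarrow> bool" where
  "hom_power_associative \<mu> \<alpha> \<longleftrightarrow> (\<forall>n\<ge>2. nth_hom_power_associative n \<mu> \<alpha>)"

end

theory Submission
  imports Defs
begin

text \<open>
  Untwisted, the argument is this. In a right alternative algebra the right multiplications
  satisfy \<open>R\<^sub>y R\<^sub>z + R\<^sub>z R\<^sub>y = R\<^sub>w\<close> with \<open>w = yz + zy\<close>. If \<open>R\<close> sends the power \<open>x\<^sup>n\<close> to the \<open>n\<close>-th power
  of \<open>R\<^sub>x\<close>, then \<open>x x\<^sup>n\<close> and \<open>x\<^sup>n x\<close> both equal \<open>x\<^sup>n\<^sup>+\<^sup>1\<close>, so taking \<open>y = x\<^sup>n\<close> and \<open>z = x\<close> and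
  halving shows that \<open>R\<close> sends \<open>x\<^sup>n\<^sup>+\<^sup>1\<close> to the \<open>(n+1)\<close>-st power of \<open>R\<^sub>x\<close>. Power associativity is this
  law applied to \<open>x\<^sup>i\<close>.

  With a twist, the iterate of \<open>R\<^sub>x\<close> becomes the product of \<open>a\<close> with \<open>x, \<alpha>(x), \<alpha>\<^sup>2(x), \<dots>\<close> taken from
  left to right. The law to prove by induction is that multiplying \<open>\<alpha>\<^sup>n\<^sup>-\<^sup>1(a)\<close> on the right by \<open>x\<^sup>n\<close> gives this
  product (\<open>mult_hom_power\<close>). The induction has to range over all \<open>a\<close> and \<open>x\<close> at once: moving the
  first factor \<open>x\<close> into \<open>a\<close> leaves a product of the same kind for \<open>\<alpha>(x)\<close>, and multiplicativity is
  what makes \<open>\<alpha>(x\<^sup>n)\<close> the Hom-power of \<open>\<alpha>(x)\<close> needed there.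
\<close>

primrec iterated_right_mult :: "('a \<Rightarrow> 'a \<Rightarrow> 'a) \<Rightarrow> ('a \<Rightarrow> 'a) \<Rightarrow> 'a \<Rightarrow> nat \<Rightarrow> 'a \<Rightarrow> 'a" where
  "iterated_right_mult \<mu> \<alpha> x 0 a = a"
| "iterated_right_mult \<mu> \<alpha> x (Suc n) a = \<mu> (iterated_right_mult \<mu> \<alpha> x n a) ((\<alpha> ^^ n) x)"

lemma iterated_right_mult_add:
  "iterated_right_mult \<mu> \<alpha> x (m + n) a =
     iterated_right_mult \<mu> \<alpha> ((\<alpha> ^^ m) x) n (iterated_right_mult \<mu> \<alpha> x m a)"
proof (induction n)
  case (Suc n)
  have "(\<alpha> ^^ (m + n)) x = (\<alpha> ^^ n) ((\<alpha> ^^ m) x)"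
    by (metis add.commute comp_apply funpow_add)
  with Suc show ?case by simp
qed simp

lemma hom_power_Suc_eq_iterated_right_mult:
  "hom_power \<mu> \<alpha> x (Suc n) = iterated_right_mult \<mu> \<alpha> x n x"
  by (induction n) simp_all

locale right_hom_alternative_algebra = hom_algebra scale \<mu> \<alpha>
  for scale :: "'k::field \<Rightarrow> 'a::ab_group_add \<Rightarrow> 'a" and \<mu> \<alpha> +
  assumes multiplicative: "multiplicative \<mu> \<alpha>"
    and right_hom_alternative: "right_hom_alternative \<mu> \<alpha>"
    and two_neq_zero: "(2::'k) \<noteq> 0"
begin

abbreviation iter_mult :: "'a \<Rightarrow> nat \<Rightarrow> 'a \<Rightarrow> 'a" where
  "iter_mult \<equiv> iterated_right_mult \<mu> \<alpha>"

lemma mult_add_left: "\<mu> (x + y) z = \<mu> x z + \<mu> y z"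
  using linear_mult_left[of z] by (rule Vector_Spaces.linear.axioms(3)[THEN module_hom.add])

lemma mult_add_right: "\<mu> x (y + z) = \<mu> x y + \<mu> x z"
  using linear_mult_right[of x] by (rule Vector_Spaces.linear.axioms(3)[THEN module_hom.add])

lemma twist_mult: "\<alpha> (\<mu> x y) = \<mu> (\<alpha> x) (\<alpha> y)"
  using multiplicative by (simp add: multiplicative_def)

lemma double_cancel:
  fixes u v :: 'a
  assumes "u + u = v + v"
  shows "u = v"
proof -
  have double: "scale 2 w = w + w" for w
    using scale_left_distrib[of 1 1 w] by simp
  have "scale 2 u = scale 2 v"
    using assms by (simp add: double)
  then show ?thesis
    using two_neq_zero by simp
qed

text \<open>Polarization: substitute \<open>y + z\<close> into the right Hom-alternative law and cancel its
  instances at \<open>y\<close> and at \<open>z\<close>.\<close>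

lemma right_hom_alternative_linearized:
  "\<mu> (\<mu> x y) (\<alpha> z) + \<mu> (\<mu> x z) (\<alpha> y) = \<mu> (\<alpha> x) (\<mu> y z + \<mu> z y)"
proof -
  have alt: "\<mu> (\<mu> x y) (\<alpha> y) = \<mu> (\<alpha> x) (\<mu> y y)" for y
    using right_hom_alternative by (simp add: right_hom_alternative_def)
  have twist_add: "\<alpha> (y + z) = \<alpha> y + \<alpha> z"
    using linear_twist by (rule Vector_Spaces.linear.axioms(3)[THEN module_hom.add])
  show ?thesis
    using alt[of "y + z"]
    by (simp add: twist_add mult_add_left mult_add_right alt[of y] alt[of z] algebra_simps)
qed

lemma twist_funpow_mult: "(\<alpha> ^^ n) (\<mu> x y) = \<mu> ((\<alpha> ^^ n) x) ((\<alpha> ^^ n) y)"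
  by (induction n) (simp_all add: twist_mult)

lemma twist_funpow_iter_mult:
  "(\<alpha> ^^ m) (iter_mult x n a) = iter_mult ((\<alpha> ^^ m) x) n ((\<alpha> ^^ m) a)"
proof (induction n)
  case (Suc n)
  have "(\<alpha> ^^ m) ((\<alpha> ^^ n) x) = (\<alpha> ^^ n) ((\<alpha> ^^ m) x)"
    by (metis add.commute comp_apply funpow_add)
  with Suc show ?case by (simp add: twist_funpow_mult)
qed simp

text \<open>The twisted form of the law that \<open>R\<close> sends \<open>x\<^sup>n\<close> to the \<open>n\<close>-th power of \<open>R\<^sub>x\<close>. The
  induction hypothesis enters three times: at \<open>a = x\<close> to see that the next
  Hom-power of \<open>x\<close> is half of a symmetrized product, and once for each of the two terms that the linearized
  law then produces.\<close>

lemma mult_hom_power: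
  "\<mu> ((\<alpha> ^^ n) a) (hom_power \<mu> \<alpha> x (Suc n)) = iter_mult x (Suc n) a"
  unfolding hom_power_Suc_eq_iterated_right_mult
proof (induction n arbitrary: a x)
  case 0
  show ?case by simp
next
  case (Suc n)
  let ?y = "iter_mult x n x" and ?z = "(\<alpha> ^^ n) x" and ?p = "iter_mult x (Suc n) x"
  let ?b = "(\<alpha> ^^ n) a" and ?q = "iter_mult x (Suc (Suc n)) a"
  have "\<mu> ?y ?z + \<mu> ?z ?y = ?p + ?p"
    using Suc.IH[of x x] by simp
  then have "\<mu> (\<alpha> ?b) ?p + \<mu> (\<alpha> ?b) ?p = \<mu> (\<mu> ?b ?y) (\<alpha> ?z) + \<mu> (\<mu> ?b ?z) (\<alpha> ?y)"
    by (simp only: right_hom_alternative_linearized flip: mult_add_right)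
  also have "\<mu> (\<mu> ?b ?y) (\<alpha> ?z) = ?q"
    using Suc.IH[of a x] by simp
  also have "\<mu> (\<mu> ?b ?z) (\<alpha> ?y) = ?q"
  proof -
    have "\<mu> (\<mu> ?b ?z) (\<alpha> ?y) = \<mu> ((\<alpha> ^^ n) (\<mu> a x)) (iter_mult (\<alpha> x) n (\<alpha> x))"
      using twist_funpow_iter_mult[of 1 x n x] by (simp add: twist_funpow_mult)
    also have "\<dots> = iter_mult (\<alpha> x) (Suc n) (\<mu> a x)"
      by (rule Suc.IH)
    also have "\<dots> = ?q"
      using iterated_right_mult_add[of \<mu> \<alpha> x 1 "Suc n" a] by simp
    finally show ?thesis .
  qed
  finally have "\<mu> (\<alpha> ?b) ?p = ?q"
    by (rule double_cancel)
  then show ?case by simp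
qed

text \<open>By multiplicativity the right factor \<open>\<alpha>\<^sup>i\<^sup>-\<^sup>1(x\<^sup>j)\<close> is the \<open>j\<close>-th Hom-power of \<open>\<alpha>\<^sup>i\<^sup>-\<^sup>1(x)\<close>.
  Multiplying by it appends the factors \<open>\<alpha>\<^sup>i\<^sup>-\<^sup>1(x), \<dots>, \<alpha>\<^sup>i\<^sup>+\<^sup>j\<^sup>-\<^sup>2(x)\<close> to \<open>x\<^sup>i\<close>, which are
  exactly those that take \<open>x\<^sup>i\<close> to \<open>x\<^sup>i\<^sup>+\<^sup>j\<close>.\<close>

lemma hom_power2_eq_hom_power_add:
  assumes "0 < i" and "0 < j"
  shows "hom_power2 \<mu> \<alpha> x i j = hom_power \<mu> \<alpha> x (i + j)"
proof -
  obtain m n where [simp]: "i = Suc m" "j = Suc n"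
    using assms by (metis gr0_implies_Suc)
  have "hom_power2 \<mu> \<alpha> x i j =
      \<mu> ((\<alpha> ^^ n) (hom_power \<mu> \<alpha> x i)) (hom_power \<mu> \<alpha> ((\<alpha> ^^ m) x) (Suc n))"
    by (simp add: hom_power2_def hom_power_Suc_eq_iterated_right_mult twist_funpow_iter_mult)
  also have "\<dots> = iter_mult ((\<alpha> ^^ m) x) (Suc n) (iter_mult x m x)"
    by (simp only: mult_hom_power \<open>i = Suc m\<close> hom_power_Suc_eq_iterated_right_mult[of _ _ _ m])
  also have "\<dots> = iter_mult x (m + Suc n) x"
    by (rule iterated_right_mult_add[symmetric])
  also have "\<dots> = hom_power \<mu> \<alpha> x (i + j)"
    using hom_power_Suc_eq_iterated_right_mult[of \<mu> \<alpha> x "m + Suc n"] by simp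
  finally show ?thesis .
qed

end

theorem theorem3p2:
  fixes scale :: "'k::field_char_0 \<Rightarrow> 'a::ab_group_add \<Rightarrow> 'a"
    and \<mu> :: "'a \<Rightarrow> 'a \<Rightarrow> 'a" and \<alpha> :: "'a \<Rightarrow> 'a"
  assumes "hom_algebra scale \<mu> \<alpha>"
    and "multiplicative \<mu> \<alpha>"
    and "right_hom_alternative \<mu> \<alpha>"
  shows "hom_power_associative \<mu> \<alpha>"
proof -
  interpret hom_algebra scale \<mu> \<alpha> by fact
  interpret right_hom_alternative_algebra scale \<mu> \<alpha>
    by unfold_locales (simp_all add: assms)
  show ?thesis
    unfolding hom_power_associative_def nth_hom_power_associative_def
    by (auto simp: hom_power2_eq_hom_power_add)
qed

end
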